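(* Let $\mathbb{S}_{(a_1,\ldots,a_k)}\times\{a_{k+1}\}\times\cdots\times\{a_n\}\subset\mathbb{H}^n$ be a balloon. Then the set $E_{\mathbb{S}_{(a_1,\ldots,a_k)}\times\{a_{k+1}\}\times\cdots\times\{a_n\}}$ is a right ideal of $\mathbb{H}[q_1,\ldots,q_n]$ contained in $E_{(a_1,\ldots,a_n)}$.
   Context: $\mathbb{H}$ is the skew field of quaternions. A slice regular polynomial in $n$ variables is a function $P:\mathbb{H}^n\to\mathbb{H}$ of the form $P(q_1,\ldots,q_n)=\sum_{\ell} q_1^{\ell_1}\cdots q_n^{\ell_n}a_{\ell_1,\ldots,\ell_n}$ (finite sum over multi-indices, variables in this fixed order, coefficients in $\mathbb{H}$ on the right). $\mathbb{H}[q_1,\ldots,q_n]$ is the set of these; it is a (non-commutative) ring under $+$ and the $*$-product, the biadditive extension of $(q_1^{\ell_1}\cdots q_n^{\ell_n}a)*(q_1^{m_1}\cdots q_n^{m_n}b)=q_1^{\ell_1+m_1}\cdots q_n^{\ell_n+m_n}ab$. Right ideals are taken with respect to this ring structure. For $U\subseteq\mathbb{H}^n$, $E_U$ is the set of $P\in\mathbb{H}[q_1,\ldots,q_n]$ vanishing at every point of $U$; $E_{(a_1,\ldots,a_n)}$ is $E_U$ for $U=\{(a_1,\ldots,a_n)\}$. Let $\mathbb{S}_{(a_1,\ldots,a_k)}=\{(g^{-1}a_1g,\ldots,g^{-1}a_kg): g\in\mathbb{H}\setminus\{0\}\}$; it is called an arranged spherical set if $a_la_m=a_ma_l$ for all $1\le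 l,m\le k$. A balloon is a set $\mathbb{S}_{(a_1,\ldots,a_k)}\times\{a_{k+1}\}\times\cdots\times\{a_n\}$ where $\mathbb{S}_{(a_1,\ldots,a_k)}$ is an arranged spherical set and $a_la_m=a_ma_l$ for all $l,m>k$. *)

theory Defs
  imports
    Complex_Main
    "HOL-Library.Poly_Mapping"
    "HOL-Computational_Algebra.Polynomial"
    "HOL-Algebra.Ideal"
begin

section \<open>Quaternions\<close>

codatatype quat = Quat (qRe: real) (qI: real) (qJ: real) (qK: real)

lemma quat_eq_iff: "x = y \<longleftrightarrow> qRe x = qRe y \<and> qI x = qI y \<and> qJ x = qJ y \<and> qK x = qK y"
  by (auto intro: quat.expand)

instantiation quat :: ab_group_add
begin

primcorec zero_quat where
  "qRe 0 = 0" | "qI 0 = 0" | "qJ 0 = 0" | "qK 0 = 0"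

primcorec plus_quat where
  "qRe (x + y) = qRe x + qRe y"
| "qI (x + y) = qI x + qI y"
| "qJ (x + y) = qJ x + qJ y"
| "qK (x + y) = qK x + qK y"

primcorec uminus_quat where
  "qRe (- x) = - qRe x"
| "qI (- x) = - qI x"
| "qJ (- x) = - qJ x"
| "qK (- x) = - qK x"

primcorec minus_quat where
  "qRe (x - y) = qRe x - qRe y"
| "qI (x - y) = qI x - qI y"
| "qJ (x - y) = qJ x - qJ y"
| "qK (x - y) = qK x - qK y"

instance
  by standard (simp_all add: quat_eq_iff)

end

instantiation quat :: real_div_algebra
begin

primcorec one_quat where
  "qRe 1 = 1" | "qI 1 = 0" | "qJ 1 = 0" | "qK 1 = 0"

primcorec times_quat where
  "qRe (x * y) = qRe x * qRe y - qI x * qI y - qJ x * qJ y - qK x * qK y"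
| "qI (x * y) = qRe x * qI y + qI x * qRe y + qJ x * qK y - qK x * qJ y"
| "qJ (x * y) = qRe x * qJ y - qI x * qK y + qJ x * qRe y + qK x * qI y"
| "qK (x * y) = qRe x * qK y + qI x * qJ y - qJ x * qI y + qK x * qRe y"

primcorec scaleR_quat where
  "qRe (scaleR r x) = r * qRe x"
| "qI (scaleR r x) = r * qI x"
| "qJ (scaleR r x) = r * qJ x"
| "qK (scaleR r x) = r * qK x"

primcorec inverse_quat where
  "qRe (inverse x) = qRe x / ((qRe x)\<^sup>2 + (qI x)\<^sup>2 + (qJ x)\<^sup>2 + (qK x)\<^sup>2)"
| "qI (inverse x) = - qI x / ((qRe x)\<^sup>2 + (qI x)\<^sup>2 + (qJ x)\<^sup>2 + (qK x)\<^sup>2)"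
| "qJ (inverse x) = - qJ x / ((qRe x)\<^sup>2 + (qI x)\<^sup>2 + (qJ x)\<^sup>2 + (qK x)\<^sup>2)"
| "qK (inverse x) = - qK x / ((qRe x)\<^sup>2 + (qI x)\<^sup>2 + (qJ x)\<^sup>2 + (qK x)\<^sup>2)"

definition "x div y = x * inverse y" for x y :: quat

instance
proof
  fix x y z :: quat and r s :: real
  show "x * y * z = x * (y * z)" "(x + y) * z = x * z + y * z" "x * (y + z) = x * y + x * z"
    by (simp_all add: quat_eq_iff algebra_simps)
  show "1 * x = x" "x * 1 = x" "(0::quat) \<noteq> 1" "scaleR 1 x = x"
    by (simp_all add: quat_eq_iff)
  show "scaleR r (x + y) = scaleR r x + scaleR r y" "scaleR (r + s) x = scaleR r x + scaleR s x"
    "scaleR r (scaleR s x) = scaleR (r * s) x"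
    "scaleR r x * y = scaleR r (x * y)" "x * scaleR r y = scaleR r (x * y)"
    by (simp_all add: quat_eq_iff algebra_simps)
  show "x div y = x * inverse y"
    by (simp add: divide_quat_def)
  show "inverse (0::quat) = 0"
    by (simp add: quat_eq_iff)
  assume "x \<noteq> 0"
  define N where "N = (qRe x)\<^sup>2 + (qI x)\<^sup>2 + (qJ x)\<^sup>2 + (qK x)\<^sup>2"
  have "N \<noteq> 0"
    using \<open>x \<noteq> 0\<close> by (auto simp: N_def quat_eq_iff add_nonneg_eq_0_iff)
  then have one: "qRe x * qRe x / N + qI x * qI x / N + qJ x * qJ x / N + qK x * qK x / N = 1"
    by (simp add: N_def power2_eq_square flip: add_divide_distrib)
  have inv: "inverse x = Quat (qRe x / N) (- qI x / N) (- qJ x / N) (- qK x / N)"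
    by (simp add: quat_eq_iff N_def)
  show "inverse x * x = 1" "x * inverse x = 1"
    unfolding inv using one by (simp_all add: quat_eq_iff mult.commute)
qed

end

lemma quat_sum_sel:
  "qRe (\<Sum>x\<in>A. f x) = (\<Sum>x\<in>A. qRe (f x))"
  "qI (\<Sum>x\<in>A. f x) = (\<Sum>x\<in>A. qI (f x))"
  "qJ (\<Sum>x\<in>A. f x) = (\<Sum>x\<in>A. qJ (f x))"
  "qK (\<Sum>x\<in>A. f x) = (\<Sum>x\<in>A. qK (f x))"
  by (induction A rule: infinite_finite_induct; simp)+


section \<open>Slice regular polynomials\<close>

text \<open>Points of $\mathbb{H}^n$ are indexed by \<open>{1..n}\<close>, and polynomials are functions on
  $\mathbb{H}^n$; both are taken extensional, so that equality of points and of functions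
  is \<open>=\<close>.\<close>

definition quat_space :: "nat \<Rightarrow> (nat \<Rightarrow> quat) set" where
  "quat_space n = {1..n} \<rightarrow>\<^sub>E UNIV"

text \<open>The product $q_1^{\ell_1} \cdots q_n^{\ell_n}$, in this order.\<close>

definition slice_monom :: "nat \<Rightarrow> (nat \<Rightarrow>\<^sub>0 nat) \<Rightarrow> (nat \<Rightarrow> quat) \<Rightarrow> quat" where
  "slice_monom n l q = prod_list (map (\<lambda>i. q i ^ Poly_Mapping.lookup l i) [1..<Suc n])"

definition coeff_families :: "nat \<Rightarrow> ((nat \<Rightarrow>\<^sub>0 nat) \<Rightarrow>\<^sub>0 quat) set" where
  "coeff_families n = {c. \<forall>l\<in>Poly_Mapping.keys c. Poly_Mapping.keys l \<subseteq> {1..n}}"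

definition slice_eval :: "nat \<Rightarrow> ((nat \<Rightarrow>\<^sub>0 nat) \<Rightarrow>\<^sub>0 quat) \<Rightarrow> (nat \<Rightarrow> quat) \<Rightarrow> quat" where
  "slice_eval n c = (\<lambda>q\<in>quat_space n.
     \<Sum>l\<in>Poly_Mapping.keys c. slice_monom n l q * Poly_Mapping.lookup c l)"

definition slice_polys :: "nat \<Rightarrow> ((nat \<Rightarrow> quat) \<Rightarrow> quat) set" where
  "slice_polys n = slice_eval n ` coeff_families n"

text \<open>The coefficients of a polynomial function; they are unique by \<open>slice_eval_inj\<close> below.\<close>

definition slice_coeffs :: "nat \<Rightarrow> ((nat \<Rightarrow> quat) \<Rightarrow> quat) \<Rightarrow> (nat \<Rightarrow>\<^sub>0 nat) \<Rightarrow>\<^sub>0 quat" where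
  "slice_coeffs n P = (THE c. c \<in> coeff_families n \<and> slice_eval n c = P)"

text \<open>The \<open>*\<close>-product. The product of coefficient families is the convolution
  $(c d)_\ell = \sum_{r + s = \ell} c_r d_s$ of \<^theory>\<open>HOL-Library.Poly_Mapping\<close>; on monomials
  this is the defining rule, see \<open>slice_mult_monom\<close> below.\<close>

definition slice_mult ::
  "nat \<Rightarrow> ((nat \<Rightarrow> quat) \<Rightarrow> quat) \<Rightarrow> ((nat \<Rightarrow> quat) \<Rightarrow> quat) \<Rightarrow> (nat \<Rightarrow> quat) \<Rightarrow> quat" where
  "slice_mult n P Q = slice_eval n (slice_coeffs n P * slice_coeffs n Q)"

definition slice_ring :: "nat \<Rightarrow> ((nat \<Rightarrow> quat) \<Rightarrow> quat) ring" where
  "slice_ring n =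
    \<lparr>carrier = slice_polys n,
     mult = slice_mult n,
     one = (\<lambda>q\<in>quat_space n. 1),
     zero = (\<lambda>q\<in>quat_space n. 0),
     add = (\<lambda>P Q. \<lambda>q\<in>quat_space n. P q + Q q)\<rparr>"

locale right_ideal = additive_subgroup I R + ring R for I and R (structure) +
  assumes I_r_closed: "\<lbrakk>a \<in> I; x \<in> carrier R\<rbrakk> \<Longrightarrow> a \<otimes> x \<in> I"

definition vanishing :: "nat \<Rightarrow> (nat \<Rightarrow> quat) set \<Rightarrow> ((nat \<Rightarrow> quat) \<Rightarrow> quat) set" where
  "vanishing n U = {P \<in> slice_polys n. \<forall>q\<in>U. P q = 0}"


subsection \<open>Uniqueness of coefficients\<close>

lemma digit_sum_less:
  fixes f :: "nat \<Rightarrow> nat"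
  assumes "\<And>i. i \<in> {1..n} \<Longrightarrow> f i < N" "0 < N"
  shows "(\<Sum>i=1..n. N ^ i * f i) < N ^ Suc n"
  using assms(1)
proof (induction n)
  case 0
  then show ?case using \<open>0 < N\<close> by simp
next
  case (Suc n)
  have "(\<Sum>i=1..n. N ^ i * f i) < N ^ Suc n"
    using Suc by simp
  moreover have "N ^ Suc n * (f (Suc n) + 1) \<le> N ^ Suc n * N"
    using Suc.prems[of "Suc n"] by (intro mult_left_mono) auto
  moreover have "N ^ Suc (Suc n) = N ^ Suc n * N" by simp
  moreover have "(\<Sum>i=1..Suc n. N ^ i * f i) = (\<Sum>i=1..n. N ^ i * f i) + N ^ Suc n * f (Suc n)"
    by simp
  ultimately show ?case
    by (simp only: distrib_left mult_1_right)
qed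

lemma digit_sum_inj:
  fixes f g :: "nat \<Rightarrow> nat"
  assumes "\<And>i. i \<in> {1..n} \<Longrightarrow> f i < N" "\<And>i. i \<in> {1..n} \<Longrightarrow> g i < N" "0 < N"
    and "(\<Sum>i=1..n. N ^ i * f i) = (\<Sum>i=1..n. N ^ i * g i)"
  shows "\<forall>i\<in>{1..n}. f i = g i"
  using assms(1,2,4)
proof (induction n)
  case (Suc n)
  define A B where "A = (\<Sum>i=1..n. N ^ i * f i)" and "B = (\<Sum>i=1..n. N ^ i * g i)"
  have lt: "A < N ^ Suc n" "B < N ^ Suc n"
    unfolding A_def B_def using Suc.prems(1,2) \<open>0 < N\<close>
    by (intro digit_sum_less; simp)+
  have eq: "A + N ^ Suc n * f (Suc n) = B + N ^ Suc n * g (Suc n)"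
    using Suc.prems(3) unfolding A_def B_def by simp
  have "A = (A + N ^ Suc n * f (Suc n)) mod N ^ Suc n"
    "f (Suc n) = (A + N ^ Suc n * f (Suc n)) div N ^ Suc n"
    "B = (B + N ^ Suc n * g (Suc n)) mod N ^ Suc n"
    "g (Suc n) = (B + N ^ Suc n * g (Suc n)) div N ^ Suc n"
    using lt \<open>0 < N\<close> by (simp_all del: power_Suc)
  then have "A = B" "f (Suc n) = g (Suc n)"
    using eq by metis+
  moreover from \<open>A = B\<close> have "\<forall>i\<in>{1..n}. f i = g i"
    unfolding A_def B_def using Suc.prems(1,2) by (intro Suc.IH) auto
  ultimately show ?case
    by (auto simp: atLeastAtMostSuc_conv)
qed simp

lemma real_coeffs_zero:
  fixes c :: "'a \<Rightarrow> real"
  assumes "finite S" "inj_on D S" "\<And>t. (\<Sum>l\<in>S. t ^ D l * c l) = 0" "l \<in> S"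
  shows "c l = 0"
proof -
  define p where "p = (\<Sum>l\<in>S. monom (c l) (D l))"
  have "poly p t = 0" for t
    using assms(3)[of t] by (simp add: p_def poly_sum poly_monom mult.commute)
  then have "p = 0"
    using poly_all_0_iff_0 by blast
  have "coeff p (D l) = (\<Sum>l'\<in>S. if l' = l then c l' else 0)"
    unfolding p_def coeff_sum
    by (rule sum.cong) (use assms(2,4) in \<open>auto simp: inj_on_def\<close>)
  also have "\<dots> = c l"
    using assms(1,4) by simp
  finally show ?thesis
    using \<open>p = 0\<close> by simp
qed

lemma slice_monom_real:
  assumes "\<And>i. i \<in> {1..n} \<Longrightarrow> q i = of_real (t ^ (N ^ i))"
  shows "slice_monom n l q = of_real (t ^ (\<Sum>i=1..n. N ^ i * Poly_Mapping.lookup l i))"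
  using assms
proof (induction n)
  case (Suc n)
  have "slice_monom (Suc n) l q = slice_monom n l q * q (Suc n) ^ Poly_Mapping.lookup l (Suc n)"
    by (simp add: slice_monom_def)
  also have "\<dots> = of_real (t ^ (\<Sum>i=1..Suc n. N ^ i * Poly_Mapping.lookup l i))"
    using Suc by (simp add: power_add flip: power_mult)
  finally show ?case .
qed (simp add: slice_monom_def)

lemma slice_eval_eq_0:
  assumes "c \<in> coeff_families n" "\<And>q. q \<in> quat_space n \<Longrightarrow> slice_eval n c q = 0"
  shows "c = 0"
proof -
  define K where "K = Poly_Mapping.keys c"
  define N where "N = Suc (Max (insert 0 ((\<lambda>(l, i). Poly_Mapping.lookup l i) ` (K \<times> {1..n}))))"
  define D where "D l = (\<Sum>i=1..n. N ^ i * Poly_Mapping.lookup l i)" for l :: "nat \<Rightarrow>\<^sub>0 nat"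
  have finK: "finite K" by (simp add: K_def)
  have lt: "Poly_Mapping.lookup l i < N" if "l \<in> K" "i \<in> {1..n}" for l i
  proof -
    have "Poly_Mapping.lookup l i \<in> (\<lambda>(l, i). Poly_Mapping.lookup l i) ` (K \<times> {1..n})"
      by (rule image_eqI[where x="(l, i)"]) (use that in auto)
    then show ?thesis
      unfolding N_def less_Suc_eq_le using finK by (intro Max_ge) auto
  qed
  have inj: "inj_on D K"
  proof (rule inj_onI)
    fix l m assume lm: "l \<in> K" "m \<in> K" "D l = D m"
    have "\<forall>i\<in>{1..n}. Poly_Mapping.lookup l i = Poly_Mapping.lookup m i"
      using lm lt by (intro digit_sum_inj[where N=N]) (auto simp: D_def N_def)
    moreover have "Poly_Mapping.lookup l i = 0" "Poly_Mapping.lookup m i = 0" if "i \<notin> {1..n}" for i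
      using lm that assms(1) by (auto simp: coeff_families_def K_def in_keys_iff subset_iff)
    ultimately show "l = m"
      by (intro poly_mapping_eqI) metis
  qed
  have *: "(\<Sum>l\<in>K. of_real (t ^ D l) * Poly_Mapping.lookup c l) = (0::quat)" for t :: real
  proof -
    define q :: "nat \<Rightarrow> quat" where "q = (\<lambda>i\<in>{1..n}. of_real (t ^ (N ^ i)))"
    have q: "q \<in> quat_space n"
      by (simp add: q_def quat_space_def)
    have "slice_monom n l q = of_real (t ^ D l)" for l
      unfolding D_def by (rule slice_monom_real) (simp add: q_def)
    then show ?thesis
      using assms(2)[OF q] q by (simp add: slice_eval_def K_def)
  qed
  have zero: "h (Poly_Mapping.lookup c l) = 0"
    if l: "l \<in> K" and h0: "h 0 = 0" and hsum: "\<And>f. h (\<Sum>l\<in>K. f l) = (\<Sum>l\<in>K. h (f l))"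
      and hscale: "\<And>r x. h (scaleR r x) = r * h x" for l and h :: "quat \<Rightarrow> real"
  proof (rule real_coeffs_zero[OF finK inj _ l])
    fix t :: real
    have "(\<Sum>l\<in>K. t ^ D l * h (Poly_Mapping.lookup c l)) =
        h (\<Sum>l\<in>K. of_real (t ^ D l) * Poly_Mapping.lookup c l)"
      by (simp only: hsum hscale flip: scaleR_conv_of_real)
    then show "(\<Sum>l\<in>K. t ^ D l * h (Poly_Mapping.lookup c l)) = 0"
      by (simp only: * h0)
  qed
  have "Poly_Mapping.lookup c l = 0" if "l \<in> K" for l
    using zero[OF that, of qRe] zero[OF that, of qI] zero[OF that, of qJ] zero[OF that, of qK]
    by (simp add: quat_eq_iff quat_sum_sel)
  then show "c = 0"
    by (intro poly_mapping_eqI) (auto simp: K_def in_keys_iff)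
qed

lemma slice_eval_superset:
  assumes "finite S" "Poly_Mapping.keys c \<subseteq> S" "q \<in> quat_space n"
  shows "slice_eval n c q = (\<Sum>l\<in>S. slice_monom n l q * Poly_Mapping.lookup c l)"
proof -
  have "(\<Sum>l\<in>Poly_Mapping.keys c. slice_monom n l q * Poly_Mapping.lookup c l) =
      (\<Sum>l\<in>S. slice_monom n l q * Poly_Mapping.lookup c l)"
    using assms by (intro sum.mono_neutral_left) (auto simp: in_keys_iff)
  then show ?thesis
    using assms(3) by (simp add: slice_eval_def)
qed

lemma slice_eval_diff:
  assumes "q \<in> quat_space n"
  shows "slice_eval n (c - d) q = slice_eval n c q - slice_eval n d q"
proof -
  let ?S = "Poly_Mapping.keys c \<union> Poly_Mapping.keys d"
  have eval: "slice_eval n e q = (\<Sum>l\<in>?S. slice_monom n l q * Poly_Mapping.lookup e l)"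
    if "Poly_Mapping.keys e \<subseteq> ?S" for e
    using that assms by (intro slice_eval_superset) auto
  have "Poly_Mapping.keys (c - d) \<subseteq> ?S"
    by (rule keys_diff)
  then show ?thesis
    by (simp only: eval Un_upper1 Un_upper2 lookup_minus right_diff_distrib sum_subtractf)
qed

lemma slice_eval_inj: "inj_on (slice_eval n) (coeff_families n)"
proof (rule inj_onI)
  fix c d assume cd: "c \<in> coeff_families n" "d \<in> coeff_families n" "slice_eval n c = slice_eval n d"
  have "Poly_Mapping.keys (c - d) \<subseteq> Poly_Mapping.keys c \<union> Poly_Mapping.keys d"
    by (rule keys_diff)
  then have "c - d \<in> coeff_families n"
    using cd(1,2) by (auto simp: coeff_families_def)
  then have "c - d = 0"
    by (rule slice_eval_eq_0) (simp add: slice_eval_diff cd(3))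
  then show "c = d" by simp
qed

lemma slice_coeffs_eval:
  assumes "c \<in> coeff_families n"
  shows "slice_coeffs n (slice_eval n c) = c"
  unfolding slice_coeffs_def
  using assms slice_eval_inj[of n] by (intro the_equality) (auto simp: inj_on_def)

lemma slice_eval_single:
  "slice_eval n (Poly_Mapping.single l a) = (\<lambda>q\<in>quat_space n. slice_monom n l q * a)"
proof
  fix q
  show "slice_eval n (Poly_Mapping.single l a) q = (\<lambda>q\<in>quat_space n. slice_monom n l q * a) q"
    by (cases "q \<in> quat_space n")
      (simp_all add: slice_eval_superset[where S="{l}"] slice_eval_def)
qed

lemma slice_mult_monom:
  assumes "Poly_Mapping.keys l \<subseteq> {1..n}" "Poly_Mapping.keys m \<subseteq> {1..n}"
  shows "slice_mult n (\<lambda>q\<in>quat_space n. slice_monom n l q * a) (\<lambda>q\<in>quat_space n. slice_monom n m q * b)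
    = (\<lambda>q\<in>quat_space n. slice_monom n (l + m) q * (a * b))"
proof -
  have "Poly_Mapping.single l a \<in> coeff_families n" "Poly_Mapping.single m b \<in> coeff_families n"
    using assms by (auto simp: coeff_families_def)
  then show ?thesis
    by (simp add: slice_mult_def slice_coeffs_eval mult_single flip: slice_eval_single)
qed


section \<open>Balloons\<close>

definition spherical_set :: "nat \<Rightarrow> (nat \<Rightarrow> quat) \<Rightarrow> (nat \<Rightarrow> quat) set" where
  "spherical_set k a = {\<lambda>i\<in>{1..k}. inverse g * a i * g | g. g \<noteq> 0}"

definition arranged :: "nat \<Rightarrow> (nat \<Rightarrow> quat) \<Rightarrow> bool" where
  "arranged k a \<longleftrightarrow> (\<forall>l\<in>{1..k}. \<forall>m\<in>{1..k}. a l * a m = a m * a l)"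

text \<open>The set $\mathbb{S}_{(a_1,\ldots,a_k)}\times\{a_{k+1}\}\times\cdots\times\{a_n\}$.\<close>

definition balloon_set :: "nat \<Rightarrow> nat \<Rightarrow> (nat \<Rightarrow> quat) \<Rightarrow> (nat \<Rightarrow> quat) set" where
  "balloon_set n k a = {q \<in> quat_space n.
     restrict q {1..k} \<in> spherical_set k a \<and> (\<forall>i\<in>{k<..n}. q i = a i)}"

definition balloon :: "nat \<Rightarrow> nat \<Rightarrow> (nat \<Rightarrow> quat) \<Rightarrow> bool" where
  "balloon n k a \<longleftrightarrow> k \<le> n \<and> arranged k a \<and>
     (\<forall>l\<in>{k<..n}. \<forall>m\<in>{k<..n}. a l * a m = a m * a l)"

end

theory Submission
  imports Defs
begin

text \<open>Let \<open>P\<close> vanish on the balloon, let \<open>q = (x, y)\<close> be one of its points and let \<open>m\<close> be a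
  multi-index. Since the components of \<open>x\<close> commute with each other, and so do those of \<open>y\<close>, the
  value of \<open>P * q\<^sup>m b\<close> at \<open>(x, y)\<close> is \<open>x\<^sup>m\<close> times the sum of the \<open>x\<^sup>l w y\<^sup>l c\<^sub>l b\<close>, where \<open>w = y\<^sup>m\<close>. If
  \<open>w \<noteq> 0\<close>, moving \<open>w\<close> to the left conjugates \<open>x\<close> by \<open>w\<close>, and the sum becomes
  \<open>w P(w\<^sup>-\<^sup>1 x w, y) b\<close>; this is zero because the balloon is invariant under conjugation of its
  spherical part.\<close>

section \<open>The ring of slice regular polynomials\<close>

lemma slice_eval_outside: "q \<notin> quat_space n \<Longrightarrow> slice_eval n c q = undefined"
  by (simp add: slice_eval_def)

lemma slice_eval_zero: "slice_eval n 0 = (\<lambda>q\<in>quat_space n. 0)"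
  by (simp add: slice_eval_def)

lemma slice_eval_add:
  "slice_eval n (c + d) = (\<lambda>q\<in>quat_space n. slice_eval n c q + slice_eval n d q)"
proof
  fix q
  have "slice_eval n (c + d) q = slice_eval n c q + slice_eval n d q" if "q \<in> quat_space n"
    \<comment> \<open>Since \<open>(c + d) - d = c\<close>, the rule for differences yields the rule
      for sums.\<close>
    using slice_eval_diff[OF that, of "c + d" d] by simp
  then show "slice_eval n (c + d) q = (\<lambda>q\<in>quat_space n. slice_eval n c q + slice_eval n d q) q"
    by (cases "q \<in> quat_space n") (simp_all add: slice_eval_outside)
qed

lemma slice_eval_sum:
  assumes "q \<in> quat_space n"
  shows "slice_eval n (\<Sum>x\<in>A. f x) q = (\<Sum>x\<in>A. slice_eval n (f x) q)"
  using assms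
  by (induction A rule: infinite_finite_induct) (simp_all add: slice_eval_zero slice_eval_add)

lemma poly_mapping_eq_sum_single:
  "c = (\<Sum>l\<in>Poly_Mapping.keys c. Poly_Mapping.single l (Poly_Mapping.lookup c l))"
  by (rule poly_mapping_eqI) (auto simp: lookup_sum lookup_single when_def in_keys_iff)

text \<open>Splitting both families into single terms turns the convolution into a double sum of
  products of monomials. The terms of the right factor are put outside, so that the inner sum runs
  over the left factor with \<open>m\<close> fixed.\<close>

lemma slice_eval_mult:
  assumes "q \<in> quat_space n"
  shows "slice_eval n (c * d) q =
    (\<Sum>m\<in>Poly_Mapping.keys d. \<Sum>l\<in>Poly_Mapping.keys c.
      slice_monom n (l + m) q * (Poly_Mapping.lookup c l * Poly_Mapping.lookup d m))"
proof -
  have "c * d = (\<Sum>m\<in>Poly_Mapping.keys d. \<Sum>l\<in>Poly_Mapping.keys c.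
      Poly_Mapping.single (l + m) (Poly_Mapping.lookup c l * Poly_Mapping.lookup d m))"
    by (subst poly_mapping_eq_sum_single[of c], subst poly_mapping_eq_sum_single[of d],
        subst sum_product, subst sum.swap) (simp only: mult_single)
  then show ?thesis
    using assms by (simp add: slice_eval_sum slice_eval_single)
qed

section \<open>Coefficient families as a subring of the convolution ring\<close>

lemma coeff_families_zero: "0 \<in> coeff_families n"
  by (simp add: coeff_families_def)

lemma coeff_families_one: "1 \<in> coeff_families n"
  by (simp add: coeff_families_def)

lemma coeff_families_add:
  "c \<in> coeff_families n \<Longrightarrow> d \<in> coeff_families n \<Longrightarrow> c + d \<in> coeff_families n"
  using keys_add[of c d] by (auto simp: coeff_families_def)

lemma coeff_families_uminus: "c \<in> coeff_families n \<Longrightarrow> - c \<in> coeff_families n"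
  by (simp add: coeff_families_def in_keys_iff)

lemma coeff_families_mult:
  assumes "c \<in> coeff_families n" "d \<in> coeff_families n"
  shows "c * d \<in> coeff_families n"
  unfolding coeff_families_def
proof (intro CollectI ballI)
  fix l assume "l \<in> Poly_Mapping.keys (c * d)"
  then obtain r s where "l = r + s" "r \<in> Poly_Mapping.keys c" "s \<in> Poly_Mapping.keys d"
    using keys_mult[of c d] by blast
  then show "Poly_Mapping.keys l \<subseteq> {1..n}"
    using assms keys_add[of r s] unfolding coeff_families_def by blast
qed

lemmas coeff_families_closed =
  coeff_families_zero coeff_families_one coeff_families_add coeff_families_uminus
  coeff_families_mult

lemma slice_eval_one: "slice_eval n 1 = (\<lambda>q\<in>quat_space n. 1)"
proof -
  have "slice_monom n 0 q = 1" for q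
    by (simp add: slice_monom_def map_replicate_const)
  then show ?thesis
    by (simp add: slice_eval_single flip: single_one)
qed

lemma slice_ring_simps:
  "carrier (slice_ring n) = slice_polys n"
  "\<zero>\<^bsub>slice_ring n\<^esub> = slice_eval n 0"
  "\<one>\<^bsub>slice_ring n\<^esub> = slice_eval n 1"
  "slice_eval n c \<oplus>\<^bsub>slice_ring n\<^esub> slice_eval n d = slice_eval n (c + d)"
  by (simp_all add: slice_ring_def slice_eval_zero slice_eval_one slice_eval_add)

text \<open>Membership in \<open>coeff_families n\<close> lets \<open>slice_coeffs\<close> recover
  \<open>c\<close> and \<open>d\<close>, after which the product is convolution by
  definition.\<close>

lemma slice_ring_mult:
  assumes "c \<in> coeff_families n" "d \<in> coeff_families n"
  shows "slice_eval n c \<otimes>\<^bsub>slice_ring n\<^esub> slice_eval n d = slice_eval n (c * d)"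
  using assms by (simp add: slice_ring_def slice_mult_def slice_coeffs_eval)

lemma slice_polysE:
  assumes "P \<in> slice_polys n"
  obtains c where "c \<in> coeff_families n" "P = slice_eval n c"
  using assms by (auto simp: slice_polys_def)

lemma slice_polysI: "c \<in> coeff_families n \<Longrightarrow> slice_eval n c \<in> slice_polys n"
  by (simp add: slice_polys_def)

text \<open>\<open>slice_eval n\<close> maps \<open>coeff_families n\<close> onto the carrier and
  respects the operations, so each axiom is inherited from the convolution ring.\<close>

lemma ring_slice_ring: "ring (slice_ring n)"
proof (rule ringI)
  show "abelian_group (slice_ring n)"
  proof (rule abelian_groupI)
    fix P assume "P \<in> carrier (slice_ring n)"
    then obtain c where c: "c \<in> coeff_families n" "P = slice_eval n c"
      by (auto simp: slice_ring_simps elim: slice_polysE)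
    have "slice_eval n (- c) \<oplus>\<^bsub>slice_ring n\<^esub> P = \<zero>\<^bsub>slice_ring n\<^esub>"
      by (simp add: c slice_ring_simps)
    then show "\<exists>Q\<in>carrier (slice_ring n). Q \<oplus>\<^bsub>slice_ring n\<^esub> P = \<zero>\<^bsub>slice_ring n\<^esub>"
      using c by (auto simp: slice_ring_simps(1) intro: slice_polysI coeff_families_closed)
  qed (auto simp: slice_ring_simps add_ac elim!: slice_polysE
      intro!: slice_polysI coeff_families_closed)
  show "monoid (slice_ring n)"
    by (rule monoidI) (auto simp: slice_ring_simps slice_ring_mult coeff_families_closed mult.assoc
        elim!: slice_polysE intro!: slice_polysI)
qed (auto simp: slice_ring_simps slice_ring_mult coeff_families_closed algebra_simps
    elim!: slice_polysE)

section \<open>Additive structure of vanishing sets\<close>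

text \<open>Zero and sums are evaluated pointwise inside \<open>quat_space n\<close>; outside it
  polynomials take the value \<open>undefined\<close>, hence the bound on \<open>U\<close>.\<close>

lemma additive_subgroup_vanishing:
  assumes "U \<subseteq> quat_space n"
  shows "additive_subgroup (vanishing n U) (slice_ring n)"
proof -
  interpret ring "slice_ring n"
    by (rule ring_slice_ring)
  have in_space: "q \<in> quat_space n" if "q \<in> U" for q
    using that assms by blast
  have zero: "\<zero>\<^bsub>slice_ring n\<^esub> q = 0" if "q \<in> U" for q
    using in_space[OF that] by (simp add: slice_ring_def)
  have add: "(P \<oplus>\<^bsub>slice_ring n\<^esub> Q) q = P q + Q q" if "q \<in> U" for P Q q
    using in_space[OF that] by (simp add: slice_ring_def)
  show ?thesis
  proof (intro additive_subgroupI add.subgroupI)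
    show "vanishing n U \<subseteq> carrier (slice_ring n)"
      by (auto simp: vanishing_def slice_ring_simps)
    have "\<zero>\<^bsub>slice_ring n\<^esub> \<in> vanishing n U"
      using zero_closed zero by (simp add: vanishing_def slice_ring_simps(1))
    then show "vanishing n U \<noteq> {}"
      by blast
  next
    fix P assume P: "P \<in> vanishing n U"
    then have PR: "P \<in> carrier (slice_ring n)"
      by (simp add: vanishing_def slice_ring_simps)
    \<comment> \<open>The additive inverse is known through its cancellation law; evaluating that
      law at \<open>q\<close> gives its value there.\<close>
    have "(\<ominus>\<^bsub>slice_ring n\<^esub> P) q = 0" if "q \<in> U" for q
      using l_neg[OF PR] add[OF that, of "\<ominus>\<^bsub>slice_ring n\<^esub> P" P] zero[OF that] P that
      by (simp add: vanishing_def)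
    then show "\<ominus>\<^bsub>slice_ring n\<^esub> P \<in> vanishing n U"
      using a_inv_closed[OF PR] by (simp add: vanishing_def slice_ring_simps(1))
  next
    fix P Q assume "P \<in> vanishing n U" "Q \<in> vanishing n U"
    then show "P \<oplus>\<^bsub>slice_ring n\<^esub> Q \<in> vanishing n U"
      using a_closed[of P Q] add by (auto simp: vanishing_def slice_ring_simps(1))
  qed
qed


section \<open>Monomials on balloons\<close>

lemma prod_list_commute:
  fixes x :: "'a::monoid_mult"
  assumes "\<And>y. y \<in> set ys \<Longrightarrow> x * y = y * x"
  shows "x * prod_list ys = prod_list ys * x"
  using assms
proof (induction ys)
  case (Cons y ys)
  have "x * (y * prod_list ys) = y * (x * prod_list ys)"
    using Cons.prems[of y] by (simp flip: mult.assoc)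
  also have "\<dots> = y * prod_list ys * x"
    using Cons by (simp add: mult.assoc)
  finally show ?case by simp
qed simp

lemma power_commutes_power:
  fixes x y :: "'a::monoid_mult"
  assumes "x * y = y * x"
  shows "x ^ i * y ^ j = y ^ j * x ^ i"
  using power_commuting_commutes[OF power_commuting_commutes[OF assms, symmetric], symmetric]
  by metis

text \<open>Exponents add because the bases commute: the power of the first base with exponent from
  \<open>g\<close> moves past the remaining powers with exponents from \<open>f\<close>.\<close>

lemma prod_list_power_add:
  fixes q :: "'b \<Rightarrow> 'a::monoid_mult"
  assumes "\<And>i j. i \<in> set xs \<Longrightarrow> j \<in> set xs \<Longrightarrow> q i * q j = q j * q i"
  shows "prod_list (map (\<lambda>i. q i ^ (f i + g i)) xs) =
    prod_list (map (\<lambda>i. q i ^ f i) xs) * prod_list (map (\<lambda>i. q i ^ g i) xs)"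
  using assms
proof (induction xs)
  case (Cons x xs)
  let ?F = "prod_list (map (\<lambda>i. q i ^ f i) xs)" and ?G = "prod_list (map (\<lambda>i. q i ^ g i) xs)"
  have IH: "prod_list (map (\<lambda>i. q i ^ (f i + g i)) xs) = ?F * ?G"
    using Cons by simp
  have comm: "q x ^ g x * ?F = ?F * q x ^ g x"
    by (rule prod_list_commute) (use Cons.prems in \<open>auto intro!: power_commutes_power\<close>)
  have "q x ^ f x * (q x ^ g x * ?F) * ?G = q x ^ f x * ?F * (q x ^ g x * ?G)"
    unfolding comm by (simp only: mult.assoc)
  then show ?case
    by (simp only: list.map prod_list.Cons IH power_add[of "q x"] mult.assoc)
qed simp

lemma power_intertwine:
  fixes w :: "'a::monoid_mult"
  assumes "w * r = q * w"
  shows "w * r ^ n = q ^ n * w"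
proof (induction n)
  case (Suc n)
  have "w * r ^ Suc n = q * (w * r ^ n)"
    using assms by (simp flip: mult.assoc)
  then show ?case
    by (simp add: Suc.IH mult.assoc)
qed simp

text \<open>Writing conjugation as \<open>w * r i = q i * w\<close> avoids inverses:
  \<open>w\<close> passes through one power at a time, turning each \<open>r i\<close> into
  \<open>q i\<close>.\<close>

lemma prod_list_power_intertwine:
  fixes w :: "'a::monoid_mult"
  assumes "\<And>i. i \<in> set xs \<Longrightarrow> w * r i = q i * w"
  shows "w * prod_list (map (\<lambda>i. r i ^ f i) xs) = prod_list (map (\<lambda>i. q i ^ f i) xs) * w"
  using assms
proof (induction xs)
  case (Cons x xs)
  let ?R = "prod_list (map (\<lambda>i. r i ^ f i) xs)" and ?Q = "prod_list (map (\<lambda>i. q i ^ f i) xs)"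
  have "w * (r x ^ f x * ?R) = q x ^ f x * (w * ?R)"
    using power_intertwine[of w "r x" "q x" "f x"] Cons.prems[of x] by (simp flip: mult.assoc)
  also have "w * ?R = ?Q * w"
    using Cons by simp
  finally show ?case
    by (simp add: mult.assoc)
qed simp

text \<open>Separates the spherical coordinates from the fixed ones: on a balloon, components
  commute within each group but need not commute across the two.\<close>

lemma slice_monom_split:
  assumes "k \<le> n"
  shows "slice_monom n l q =
    slice_monom k l q * prod_list (map (\<lambda>i. q i ^ Poly_Mapping.lookup l i) [Suc k..<Suc n])"
proof -
  have "[1..<Suc n] = [1..<Suc k] @ [Suc k..<Suc n]"
    using upt_add_eq_append[of 1 "Suc k" "n - k"] assms by simp
  then show ?thesis
    unfolding slice_monom_def by (simp only: map_append prod_list.append)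
qed

section \<open>Points of a balloon and shifted monomials\<close>

lemma balloon_setE:
  assumes "q \<in> balloon_set n k a"
  obtains g where "g \<noteq> 0" "\<And>i. i \<in> {1..k} \<Longrightarrow> q i = inverse g * a i * g"
    "\<And>i. i \<in> {k<..n} \<Longrightarrow> q i = a i"
proof -
  from assms obtain g where g: "g \<noteq> 0"
    "restrict q {1..k} = (\<lambda>i\<in>{1..k}. inverse g * a i * g)"
    unfolding balloon_set_def spherical_set_def by blast
  have "q i = inverse g * a i * g" if "i \<in> {1..k}" for i
    using fun_cong[OF g(2), of i] that by simp
  then show ?thesis
    using that[OF g(1)] assms by (simp add: balloon_set_def)
qed

lemma balloon_setI:
  assumes "q \<in> quat_space n" "g \<noteq> 0" "\<And>i. i \<in> {1..k} \<Longrightarrow> q i = inverse g * a i * g"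
    "\<And>i. i \<in> {k<..n} \<Longrightarrow> q i = a i"
  shows "q \<in> balloon_set n k a"
proof -
  have "restrict q {1..k} = (\<lambda>i\<in>{1..k}. inverse g * a i * g)"
    using assms(3) by (intro restrict_ext) auto
  then show ?thesis
    using assms unfolding balloon_set_def spherical_set_def by blast
qed

lemma base_point_in_balloon_set: "a \<in> quat_space n \<Longrightarrow> a \<in> balloon_set n k a"
  by (rule balloon_setI[where g = 1]) auto

text \<open>The point \<open>r\<close> and the factor \<open>u\<close> do not depend on
  \<open>l\<close>, so in a sum over \<open>l\<close> the factor comes out and a value at
  \<open>r\<close> remains.\<close>

lemma slice_monom_add_balloon:
  assumes "balloon n k a" "q \<in> balloon_set n k a"
  shows "\<exists>r\<in>balloon_set n k a. \<exists>u. \<forall>l. slice_monom n (l + m) q = u * slice_monom n l r"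
proof -
  have "k \<le> n"
    using assms(1) by (simp add: balloon_def)
  have q: "q \<in> quat_space n"
    using assms(2) by (simp add: balloon_set_def)
  obtain g where g: "g \<noteq> 0" "\<And>i. i \<in> {1..k} \<Longrightarrow> q i = inverse g * a i * g"
    "\<And>i. i \<in> {k<..n} \<Longrightarrow> q i = a i"
    using balloon_setE[OF assms(2)] by metis
  define T where "T r l = prod_list (map (\<lambda>i. r i ^ Poly_Mapping.lookup l i) [Suc k..<Suc n])"
    for r :: "nat \<Rightarrow> quat" and l
  have split: "slice_monom n l r = slice_monom k l r * T r l" for l r
    unfolding T_def by (rule slice_monom_split[OF \<open>k \<le> n\<close>])
  have commS: "q i * q j = q j * q i" if "i \<in> {1..k}" "j \<in> {1..k}" for i j
  proof -
    \<comment> \<open>All spherical components are conjugated by the same \<open>g\<close>, so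
      conjugation is multiplicative and commutation carries over from \<open>a\<close> to
      \<open>q\<close>.\<close>
    have conj: "q i * q j = inverse g * (a i * a j) * g" if "i \<in> {1..k}" "j \<in> {1..k}" for i j
    proof -
      have "q i * q j = inverse g * a i * (g * inverse g) * a j * g"
        using g(2) that by (simp only: mult.assoc)
      then show ?thesis
        using g(1) by (simp add: mult.assoc)
    qed
    have "a i * a j = a j * a i"
      using assms(1) that by (simp add: balloon_def arranged_def)
    then show ?thesis
      using conj that by simp
  qed
  have commT: "q i * q j = q j * q i" if "i \<in> {k<..n}" "j \<in> {k<..n}" for i j
    using assms(1) g(3) that by (simp add: balloon_def)
  \<comment> \<open>Swapping the exponents to \<open>m + l\<close> places the factor independent of
    \<open>l\<close> on the left; the same is done for the tail.\<close>
  have head: "slice_monom k (l + m) q = slice_monom k m q * slice_monom k l q" for l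
    unfolding slice_monom_def lookup_add add.commute[of "Poly_Mapping.lookup l _"]
    by (intro prod_list_power_add) (use commS in auto)
  have tail: "T q (l + m) = T q m * T q l" for l
    unfolding T_def lookup_add add.commute[of "Poly_Mapping.lookup l _"]
    by (intro prod_list_power_add) (use commT in auto)
  define w where "w = T q m"
  have add: "slice_monom n (l + m) q = slice_monom k m q * (slice_monom k l q * w) * T q l" for l
    by (simp only: split head tail w_def mult.assoc)
  show ?thesis
  proof (cases "w = 0")
    \<comment> \<open>All shifted monomials vanish at \<open>q\<close>, so the factor
      \<open>0\<close> works with any point of the balloon, for instance \<open>q\<close>.\<close>
    case True
    then have "\<forall>l. slice_monom n (l + m) q = 0 * slice_monom n l q"
      using add by simp
    then show ?thesis
      using assms(2) by blast
  next
    case False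
    \<comment> \<open>Only the spherical coordinates are conjugated; the restriction to
      \<open>{1..n}\<close> keeps \<open>r\<close> extensional.\<close>
    define r where "r = (\<lambda>i\<in>{1..n}. if i \<le> k then inverse w * q i * w else q i)"
    have rS: "r i = inverse w * q i * w" if "i \<in> {1..k}" for i
      using that \<open>k \<le> n\<close> by (simp add: r_def)
    have intertwine: "w * r i = q i * w" if "i \<in> {1..k}" for i
    proof -
      have "w * r i = w * inverse w * q i * w"
        by (simp only: rS[OF that] mult.assoc)
      then show ?thesis
        using False by simp
    qed
    have rT: "r i = q i" if "i \<in> {k<..n}" for i
      using that by (simp add: r_def)
    have "r \<in> balloon_set n k a"
    proof (rule balloon_setI)
      show "r \<in> quat_space n"
        by (simp add: r_def quat_space_def)
      \<comment> \<open>\<open>q i\<close> is already \<open>a i\<close> conjugated by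
        \<open>g\<close>; conjugating again by \<open>w\<close> amounts to conjugating by
        \<open>g * w\<close>.\<close>
      show "g * w \<noteq> 0"
        using g(1) False by simp
      show "r i = inverse (g * w) * a i * (g * w)" if "i \<in> {1..k}" for i
        using g(1) False
        by (simp only: rS[OF that] g(2)[OF that] nonzero_inverse_mult_distrib mult.assoc
            not_False_eq_True)
      show "r i = a i" if "i \<in> {k<..n}" for i
        using rT g(3) that by simp
    qed
    moreover have "slice_monom n (l + m) q = (slice_monom k m q * w) * slice_monom n l r" for l
    proof -
      have "w * slice_monom k l r = slice_monom k l q * w"
        unfolding slice_monom_def
        by (rule prod_list_power_intertwine) (use intertwine in auto)
      moreover have "T r l = T q l"
        unfolding T_def by (intro arg_cong[where f = prod_list] map_cong refl) (use rT in auto)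
      ultimately show ?thesis
        by (simp only: add split[of l r] mult.assoc) (metis mult.assoc)
    qed
    ultimately show ?thesis
      by blast
  qed
qed

section \<open>Closure under right multiplication\<close>

lemma vanishing_balloon_mult:
  assumes "balloon n k a" "P \<in> vanishing n (balloon_set n k a)" "Q \<in> slice_polys n"
  shows "P \<otimes>\<^bsub>slice_ring n\<^esub> Q \<in> vanishing n (balloon_set n k a)"
proof -
  obtain c where c: "c \<in> coeff_families n" "P = slice_eval n c"
    using assms(2) by (auto simp: vanishing_def elim: slice_polysE)
  obtain d where d: "d \<in> coeff_families n" "Q = slice_eval n d"
    using assms(3) by (rule slice_polysE)
  have "slice_eval n (c * d) q = 0" if q: "q \<in> balloon_set n k a" for q
  proof -
    have "(\<Sum>l\<in>Poly_Mapping.keys c.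
        slice_monom n (l + m) q * (Poly_Mapping.lookup c l * Poly_Mapping.lookup d m)) = 0" for m
    proof -
      obtain r u where r: "r \<in> balloon_set n k a"
        and u: "\<And>l. slice_monom n (l + m) q = u * slice_monom n l r"
        using slice_monom_add_balloon[OF assms(1) q, of m] by blast
      \<comment> \<open>The factor \<open>u\<close> leaves the sum on the left and the coefficient
        of \<open>Q\<close> on the right; what remains is the value of \<open>P\<close> at
        \<open>r\<close>.\<close>
      have "(\<Sum>l\<in>Poly_Mapping.keys c.
          slice_monom n (l + m) q * (Poly_Mapping.lookup c l * Poly_Mapping.lookup d m)) =
          u * (\<Sum>l\<in>Poly_Mapping.keys c. slice_monom n l r * Poly_Mapping.lookup c l) *
            Poly_Mapping.lookup d m"
        by (simp only: u sum_distrib_left sum_distrib_right mult.assoc)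
      also have "(\<Sum>l\<in>Poly_Mapping.keys c. slice_monom n l r * Poly_Mapping.lookup c l) = P r"
        using r by (simp add: c slice_eval_def balloon_set_def)
      also have "P r = 0"
        using assms(2) r by (simp add: vanishing_def)
      finally show ?thesis by simp
    qed
    moreover have "q \<in> quat_space n"
      using q by (simp add: balloon_set_def)
    ultimately show ?thesis
      by (simp only: slice_eval_mult sum.neutral_const)
  qed
  then show ?thesis
    using c d by (simp add: vanishing_def slice_ring_mult slice_polysI coeff_families_mult)
qed

theorem proposition3p16:
  fixes n k :: nat and a :: "nat \<Rightarrow> quat"
  assumes "a \<in> quat_space n"
    and "balloon n k a"
  shows "right_ideal (vanishing n (balloon_set n k a)) (slice_ring n)
    \<and> vanishing n (balloon_set n k a) \<subseteq> vanishing n {a}"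
proof
  have "balloon_set n k a \<subseteq> quat_space n"
    by (auto simp: balloon_set_def)
  then show "right_ideal (vanishing n (balloon_set n k a)) (slice_ring n)"
    by (intro right_ideal.intro right_ideal_axioms.intro additive_subgroup_vanishing
        ring_slice_ring vanishing_balloon_mult assms(2)) (auto simp: slice_ring_simps(1))
  \<comment> \<open>The base point lies in the balloon, with conjugator \<open>1\<close>, and
    vanishing on a set implies vanishing at each of its points.\<close>
  show "vanishing n (balloon_set n k a) \<subseteq> vanishing n {a}"
    using base_point_in_balloon_set[OF assms(1)] by (auto simp: vanishing_def)
qed

end
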